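(* Let $\mathcal{A}$ be a conservative paging algorithm. Let $\alpha=\alpha(k)$ divide $k$, and suppose that $|\mathcal{U}|\ge 16k\exp(8(1-\delta)^{-1}\delta^2\alpha)$ and $(1-\delta)^{-1}\le k/(2\alpha)$ for all large enough $k$. Then, for $c\ge1$, $\alpha$-way set-associative $\mathcal{A}$ is not $c$-competitive with $\mathcal{A}$ using $(1-\delta)^{-1}$-resource augmentation on request sequences of length $O(c\,\alpha\, k\exp(16(1-\delta)^{-1}\delta^2\alpha))$.
   Context: Paging: $\mathcal{U}$ is the universe of items; $\mathcal{A}_k$ is algorithm $\mathcal{A}$ on an initially empty cache of size $k$; $C(\mathcal{A}_k,\sigma)$ is its number of misses on request sequence $\sigma$. A paging algorithm is conservative if it incurs at most $k$ cache misses on any consecutive subsequence of the input containing at most $k$ distinct items. $\alpha$-way set-associative $\mathcal{A}$ with cache size $k$: pick a fully random hash function $h:\mathcal{U}\to[k/\alpha]$, partition the cache into $k/\alpha$ buckets of $\alpha$ slots, run an independent instance of $\mathcal{A}_\alpha$ on each bucket, and serve a request for $x$ in bucket $h(x)$. $\mathcal{A}$ is $c$-competitive with $\mathcal{B}$ with probability $p$ using $r$-resource augmentation on request sequences of length $\ell$ if for every $\sigma$ with $|\sigma|\le\ell$, $\Pr[C(\mathcal{A}_k,\sigma)\le c\,C(\mathcal{B}_{k'},\sigma)+O(1)]\ge p$, where $k=rk'$ (probability over the algorithm's randomness; $\sigma$ chosen by an oblivious adversary). $\mathcal{A}$ is not $c$-competitive with $\mathcal{B}$ using $r$-resource augmentation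 on sequences of length $\ell$ if it is not $c$-competitive with $\mathcal{B}$ with probability $1/2$ in that sense. *)

theory Defs
  imports "HOL-Probability.Probability"
begin

text \<open>A deterministic online algorithm running on a cache of some fixed size is given by the
  cache contents after each finite history of requests. A paging algorithm provides such a
  function for every cache size.\<close>

type_synonym 'u caching = "'u list \<Rightarrow> 'u set"

definition misses :: "'u caching \<Rightarrow> 'u list \<Rightarrow> nat" where
  "misses f \<sigma> = card {i. i < length \<sigma> \<and> \<sigma> ! i \<notin> f (take i \<sigma>)}"

text \<open>Only the requested item may enter the cache, and it must be cached once it has been served;
  evictions are unrestricted. Size 0 is excluded, since no item could be served.\<close>

definition paging_algorithm :: "(nat \<Rightarrow> 'u caching) \<Rightarrow> bool" where
  "paging_algorithm A \<longleftrightarrow>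
     (\<forall>k>0. A k [] = {} \<and>
       (\<forall>\<sigma> x. x \<in> A k (\<sigma> @ [x]) \<and> A k (\<sigma> @ [x]) \<subseteq> insert x (A k \<sigma>)) \<and>
       (\<forall>\<sigma>. finite (A k \<sigma>) \<and> card (A k \<sigma>) \<le> k))"

text \<open>The misses incurred on a segment \<open>\<tau>\<close> requested right after the prefix \<open>\<rho>\<close> number
  \<open>misses (A k) (\<rho> @ \<tau>) - misses (A k) \<rho>\<close>; requests after the segment do not affect them.\<close>

definition conservative :: "(nat \<Rightarrow> 'u caching) \<Rightarrow> bool" where
  "conservative A \<longleftrightarrow>
     (\<forall>k>0. \<forall>\<rho> \<tau>. card (set \<tau>) \<le> k \<longrightarrow> misses (A k) (\<rho> @ \<tau>) \<le> misses (A k) \<rho> + k)"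

text \<open>Bucket \<open>b\<close> runs its own instance of \<open>A a\<close> on the requests hashed to \<open>b\<close>; the cache consists
  of the contents of all \<open>k div a\<close> buckets.\<close>

definition set_associative ::
  "(nat \<Rightarrow> 'u caching) \<Rightarrow> nat \<Rightarrow> nat \<Rightarrow> ('u \<Rightarrow> nat) \<Rightarrow> 'u caching" where
  "set_associative A a k h \<sigma> = (\<Union>b<k div a. A a (filter (\<lambda>x. h x = b) \<sigma>))"

definition random_hash :: "'u set \<Rightarrow> nat \<Rightarrow> ('u \<Rightarrow> nat) measure" where
  "random_hash U m = PiM U (\<lambda>_. uniform_count_measure {..<m})"

text \<open>\<open>\<A> k \<omega>\<close> is the randomized algorithm on a cache of size \<open>k\<close> when its random choices, drawn
  from \<open>M k\<close>, are \<open>\<omega>\<close>. The universe \<open>U\<close>, the augmentation \<open>r\<close> and the length bound \<open>l\<close> may depend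
  on \<open>k\<close>, and the additive term \<open>O(1)\<close> is a constant \<open>D\<close> independent of \<open>k\<close> and \<open>\<sigma>\<close>. Sizes \<open>k\<close> for
  which \<open>k = r k'\<close> has no integral solution \<open>k'\<close> impose no condition.\<close>

definition competitive_with_prob ::
  "(nat \<Rightarrow> 'u set) \<Rightarrow> (nat \<Rightarrow> 'w measure) \<Rightarrow> (nat \<Rightarrow> 'w \<Rightarrow> 'u caching) \<Rightarrow> (nat \<Rightarrow> 'u caching) \<Rightarrow>
   real \<Rightarrow> real \<Rightarrow> (nat \<Rightarrow> real) \<Rightarrow> (nat \<Rightarrow> real) \<Rightarrow> bool" where
  "competitive_with_prob U M \<A> \<B> c p r l \<longleftrightarrow>
     (\<exists>D::real. \<forall>\<^sub>F k in sequentially. \<forall>k'. real k = r k * real k' \<longrightarrow>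
        (\<forall>\<sigma>. set \<sigma> \<subseteq> U k \<and> real (length \<sigma>) \<le> l k \<longrightarrow>
           measure (M k) {\<omega> \<in> space (M k).
             real (misses (\<A> k \<omega>) \<sigma>) \<le> c * real (misses (\<B> k') \<sigma>) + D} \<ge> p))"

definition not_competitive ::
  "(nat \<Rightarrow> 'u set) \<Rightarrow> (nat \<Rightarrow> 'w measure) \<Rightarrow> (nat \<Rightarrow> 'w \<Rightarrow> 'u caching) \<Rightarrow> (nat \<Rightarrow> 'u caching) \<Rightarrow>
   real \<Rightarrow> (nat \<Rightarrow> real) \<Rightarrow> (nat \<Rightarrow> real) \<Rightarrow> bool" where
  "not_competitive U M \<A> \<B> c r l \<longleftrightarrow> \<not> competitive_with_prob U M \<A> \<B> c (1/2) r l"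

end

theory Submission
  imports Defs
begin

text \<open>
  Write \<open>m = k / \<alpha>\<close> for the number of buckets and \<open>e = (1 - \<delta>)\<inverse> \<delta>\<^sup>2 \<alpha>\<close>. The adversary takes about
  \<open>16 (1 - \<delta>)\<inverse> exp (8 e)\<close> disjoint blocks of \<open>k'\<close> items and cycles \<open>R\<close> times through each block
  before moving on to the next. A conservative algorithm with a cache of size \<open>k'\<close> misses at most \<open>k'\<close>
  times per block, whereas a bucket receiving more than \<open>\<alpha>\<close> items of some block misses on every pass
  through that block.

  The load of a bucket from one block is binomial with \<open>k'\<close> trials and mean \<open>(1 - \<delta>) \<alpha>\<close>. With
  success probability \<open>\<alpha> / k'\<close> instead of \<open>\<alpha> / k\<close> the mean would be the integer \<open>\<alpha>\<close>, and the load would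
  exceed it with probability at least \<open>2 / 9\<close>; the Cauchy-Schwarz inequality transfers this to a bound
  \<open>4 / 81 exp (- 2 e)\<close> for the true load. The blocks being independent, a given bucket is never
  overloaded with probability at most \<open>0.497\<close>. Markov's inequality over the buckets then makes more
  than \<open>m / 200\<close> of them overloaded with probability more than \<open>1 / 2\<close>, which costs \<open>R m / 200\<close> misses
  and exceeds the allowance once \<open>R\<close> is large enough.
\<close>

section \<open>Tails of the binomial distribution\<close>

lemma pmf_binomial_Suc:
  assumes "0 \<le> p" "p \<le> 1"
  shows "pmf (binomial_pmf n p) (Suc j) * real (Suc j) * (1 - p)
    = pmf (binomial_pmf n p) j * real (n - j) * p"
proof (cases "j < n")
  case True
  have choose: "real (n choose Suc j) * real (Suc j) = real (n choose j) * real (n - j)"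
    by (metis binomial_absorb_comp binomial_absorption mult.commute of_nat_mult)
  have "pmf (binomial_pmf n p) (Suc j) * real (Suc j) * (1 - p)
      = (real (n choose Suc j) * real (Suc j)) * p ^ Suc j * ((1 - p) ^ (n - Suc j) * (1 - p))"
    using assms by (simp del: of_nat_Suc)
  also have "(1 - p) ^ (n - Suc j) * (1 - p) = (1 - p) ^ (n - j)"
    using True by (metis Suc_diff_Suc power_Suc2)
  finally show ?thesis
    unfolding choose using assms by (simp add: mult_ac)
qed (use assms in simp)

lemma prob_pmf_square_le_chi_square:
  assumes "finite J" and "J \<subseteq> set_pmf P"
  shows "(measure_pmf.prob Q J)\<^sup>2 \<le> measure_pmf.prob P J * (\<Sum>x\<in>J. (pmf Q x)\<^sup>2 / pmf P x)"
proof -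
  have pos: "0 < pmf P x" if "x \<in> J" for x
    using assms(2) that by (auto intro: pmf_positive)
  have "(\<Sum>x\<in>J. pmf Q x) = (\<Sum>x\<in>J. sqrt (pmf P x) * (pmf Q x / sqrt (pmf P x)))"
    using pos by (intro sum.cong) force+
  also have "\<dots>\<^sup>2 \<le> (\<Sum>x\<in>J. (sqrt (pmf P x))\<^sup>2) * (\<Sum>x\<in>J. (pmf Q x / sqrt (pmf P x))\<^sup>2)"
    by (rule Cauchy_Schwarz_ineq_sum)
  finally show ?thesis
    using assms(1) by (simp add: measure_measure_pmf_finite power_divide)
qed

lemma sum_binomial_pmf_square_div:
  assumes p_range: "0 < p" "p < 1" and r_range: "0 \<le> r" "r \<le> 1"
  shows "(\<Sum>j\<le>n. (pmf (binomial_pmf n r) j)\<^sup>2 / pmf (binomial_pmf n p) j)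
    = (1 + (r - p)\<^sup>2 / (p * (1 - p))) ^ n"
proof -
  have "(pmf (binomial_pmf n r) j)\<^sup>2 / pmf (binomial_pmf n p) j
      = real (n choose j) * (r\<^sup>2 / p) ^ j * ((1 - r)\<^sup>2 / (1 - p)) ^ (n - j)" if "j \<le> n" for j
    using that p_range r_range by (simp add: power_divide power_mult_distrib power2_eq_square)
  then have "(\<Sum>j\<le>n. (pmf (binomial_pmf n r) j)\<^sup>2 / pmf (binomial_pmf n p) j)
      = (r\<^sup>2 / p + (1 - r)\<^sup>2 / (1 - p)) ^ n"
    by (simp add: binomial_ring)
  also have "r\<^sup>2 / p + (1 - r)\<^sup>2 / (1 - p) = 1 + (r - p)\<^sup>2 / (p * (1 - p))"
    using p_range by (simp add: field_simps power2_eq_square)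
  finally show ?thesis .
qed

lemma prob_binomial_pmf_square_le:
  assumes p_range: "0 < p" "p < 1" and r_range: "0 \<le> r" "r \<le> 1"
  shows "(measure_pmf.prob (binomial_pmf n r) J)\<^sup>2
    \<le> measure_pmf.prob (binomial_pmf n p) J * (1 + (r - p)\<^sup>2 / (p * (1 - p))) ^ n"
proof -
  let ?ratio = "\<lambda>j. (pmf (binomial_pmf n r) j)\<^sup>2 / pmf (binomial_pmf n p) j"
  have "set_pmf (binomial_pmf n r) \<subseteq> {..n}"
    using r_range by (simp add: set_pmf_binomial_eq)
  then have "measure_pmf.prob (binomial_pmf n r) J = measure_pmf.prob (binomial_pmf n r) (J \<inter> {..n})"
    by (intro measure_prob_cong_0) (auto simp: pmf_eq_0_set_pmf)
  also have "\<dots>\<^sup>2 \<le> measure_pmf.prob (binomial_pmf n p) (J \<inter> {..n}) * (\<Sum>j\<in>J \<inter> {..n}. ?ratio j)"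
    using p_range by (intro prob_pmf_square_le_chi_square) auto
  also have "\<dots> \<le> measure_pmf.prob (binomial_pmf n p) J * (\<Sum>j\<le>n. ?ratio j)"
    by (intro mult_mono measure_pmf.finite_measure_mono sum_mono2 sum_nonneg) auto
  finally show ?thesis
    by (simp only: sum_binomial_pmf_square_div[OF assms])
qed

definition binomial_mean_pmf :: "nat \<Rightarrow> nat \<Rightarrow> nat pmf" where
  "binomial_mean_pmf n a = binomial_pmf n (real a / real n)"

lemma pmf_binomial_mean_Suc:
  assumes "0 < n" "a \<le> n"
  shows "pmf (binomial_mean_pmf n a) (Suc j) * real (Suc j) * real (n - a)
    = pmf (binomial_mean_pmf n a) j * real (n - j) * real a"
proof -
  have "1 - real a / real n = real (n - a) / real n"
    using assms by (simp add: diff_divide_distrib)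
  then show ?thesis
    using pmf_binomial_Suc[of "real a / real n" n j] assms
    by (simp add: binomial_mean_pmf_def del: of_nat_Suc pmf_binomial)
qed

lemma pmf_binomial_mean_pos:
  assumes "0 < a" "a < n" "j \<le> n"
  shows "0 < pmf (binomial_mean_pmf n a) j"
  using assms by (intro pmf_positive) (simp add: binomial_mean_pmf_def)

lemma pmf_binomial_mean_cross_ratio:
  assumes mean_le: "2 * a \<le> n" and t_range: "0 < t" "t < a"
  shows "pmf (binomial_mean_pmf n a) (a - Suc t) * pmf (binomial_mean_pmf n a) (a + t - 1)
    \<le> pmf (binomial_mean_pmf n a) (a - t) * pmf (binomial_mean_pmf n a) (a + t)"
proof -
  let ?b = "pmf (binomial_mean_pmf n a)"
  define A M s where "A = real a" and "M = real (n - a)" and "s = real t"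
  have size_bounds: "0 < A" "A \<le> M" "0 < s" "s < A"
    using mean_le t_range by (auto simp: A_def M_def s_def)
  have "Suc (a - Suc t) = a - t"
    using t_range by simp
  then have lower: "?b (a - t) * (A - s) * M = ?b (a - Suc t) * (M + 1 + s) * A"
    using pmf_binomial_mean_Suc[of n a "a - Suc t"] mean_le t_range
    by (simp add: A_def M_def s_def algebra_simps)
  have upper: "?b (a + t) * (A + s) * M = ?b (a + t - 1) * (M + 1 - s) * A"
    using pmf_binomial_mean_Suc[of n a "a + t - 1"] mean_le t_range
    by (simp add: A_def M_def s_def algebra_simps)
  have "s\<^sup>2 * A\<^sup>2 \<le> s\<^sup>2 * M\<^sup>2" and "0 \<le> A\<^sup>2 * (2 * M + 1)"
    using size_bounds by (auto intro!: mult_left_mono power_mono)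
  then have weights: "(A - s) * (A + s) * M\<^sup>2 \<le> (M + 1 + s) * (M + 1 - s) * A\<^sup>2"
    by (simp add: algebra_simps power2_eq_square)
  have "(?b (a - Suc t) * ?b (a + t - 1)) * ((A - s) * (A + s) * M\<^sup>2)
      \<le> (?b (a - Suc t) * ?b (a + t - 1)) * ((M + 1 + s) * (M + 1 - s) * A\<^sup>2)"
    using weights by (intro mult_left_mono) auto
  also have "\<dots> = (?b (a - Suc t) * (M + 1 + s) * A) * (?b (a + t - 1) * (M + 1 - s) * A)"
    by (simp only: power2_eq_square mult_ac)
  also have "\<dots> = (?b (a - t) * ?b (a + t)) * ((A - s) * (A + s) * M\<^sup>2)"
    unfolding lower[symmetric] upper[symmetric] by (simp only: power2_eq_square mult_ac)
  finally show ?thesis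
    using size_bounds by (subst (asm) mult_le_cancel_right_pos) auto
qed

lemma pmf_binomial_mean_reflect_le:
  assumes mean_le: "2 * a \<le> n" and "i < a"
  shows "pmf (binomial_mean_pmf n a) (a - Suc i) \<le> pmf (binomial_mean_pmf n a) (a + i)"
  using assms(2)
proof (induction i)
  case 0
  let ?b = "pmf (binomial_mean_pmf n a)"
  have "real a * (?b a * real (n - a)) = real a * (?b (a - 1) * real (n - a + 1))"
    using pmf_binomial_mean_Suc[of n a "a - 1"] mean_le 0 by (simp add: algebra_simps)
  then have "?b a * real (n - a) = ?b (a - 1) * real (n - a + 1)"
    using 0 by (simp only: mult_cancel_left) simp
  then have "?b (a - 1) * real (n - a + 1) \<le> ?b a * real (n - a + 1)"
    by (simp add: algebra_simps)
  then show ?case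
    by simp
next
  case (Suc i)
  let ?b = "pmf (binomial_mean_pmf n a)"
  have "?b (a - Suc (Suc i)) * ?b (a + i) \<le> ?b (a - Suc i) * ?b (a + Suc i)"
    using pmf_binomial_mean_cross_ratio[OF mean_le, of "Suc i"] Suc.prems by simp
  also have "\<dots> \<le> ?b (a + Suc i) * ?b (a + i)"
    using Suc by (subst mult.commute) (intro mult_left_mono, auto)
  finally show ?case
    using pmf_binomial_mean_pos[of a n "a + i"] mean_le Suc.prems by simp
qed

lemma prob_binomial_mean_atLeast_ge:
  assumes "2 * a \<le> n"
  shows "1 / 2 \<le> measure_pmf.prob (binomial_mean_pmf n a) {a..}"
proof -
  let ?prob = "measure_pmf.prob (binomial_mean_pmf n a)" and ?b = "pmf (binomial_mean_pmf n a)"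
  have "?prob {..<a} = (\<Sum>i<a. ?b (a - Suc i))"
    by (simp only: measure_measure_pmf_finite finite_lessThan sum.nat_diff_reindex)
  also have "\<dots> \<le> (\<Sum>i<a. ?b (a + i))"
    using assms by (intro sum_mono pmf_binomial_mean_reflect_le) auto
  also have "\<dots> = ?prob ((+) a ` {..<a})"
    by (simp add: measure_measure_pmf_finite sum.reindex)
  also have "\<dots> \<le> ?prob {a..}"
    by (intro measure_pmf.finite_measure_mono) auto
  finally have "?prob {..<a} \<le> ?prob {a..}" .
  moreover have "?prob {a..} = 1 - ?prob {..<a}"
    using measure_pmf.prob_compl[of "{..<a}" "binomial_mean_pmf n a"]
    by (simp flip: Compl_eq_Diff_UNIV)
  ultimately show ?thesis
    by linarith
qed

lemma prob_binomial_mean_greaterThan_ge_pmf: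
  assumes "0 < a" "a < n"
  shows "pmf (binomial_mean_pmf n a) a * (real a / real (a + 1))
      * (1 + real a / real (a + 2) * (1 - 1 / real (n - a)))
    \<le> measure_pmf.prob (binomial_mean_pmf n a) {a<..}"
proof -
  let ?b = "pmf (binomial_mean_pmf n a)"
  have pmf_next: "?b (a + 1) = ?b a * (a / (a + 1))"
  proof -
    have "?b (a + 1) * (a + 1) * real (n - a) = ?b a * a * real (n - a)"
      using pmf_binomial_mean_Suc[of n a a] assms by (simp add: mult_ac)
    then have "?b (a + 1) * (a + 1) = ?b a * a"
      using assms by (simp only: mult_cancel_right) simp
    then show ?thesis
      by (simp add: field_simps)
  qed
  have "?b (a + 2) * (real (a + 2) * real (n - a)) = ?b (a + 1) * (real a * (real (n - a) - 1))"
    using pmf_binomial_mean_Suc[of n a "a + 1"] assms by (simp add: mult_ac)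
  then have "?b (a + 2) = ?b (a + 1) * (real a * (real (n - a) - 1)) / (real (a + 2) * real (n - a))"
    using assms by (subst eq_divide_eq) auto
  also have "\<dots> = ?b (a + 1) * (a / (a + 2) * (1 - 1 / real (n - a)))"
    using assms by (simp add: field_simps)
  finally have pmf_second: "?b (a + 2) = \<dots>" .
  have "?b a * (a / (a + 1)) * (1 + a / (a + 2) * (1 - 1 / real (n - a))) = ?b (a + 1) + ?b (a + 2)"
    unfolding pmf_second pmf_next by (simp only: distrib_left mult_1_right)
  also have "\<dots> = measure_pmf.prob (binomial_mean_pmf n a) {a + 1, a + 2}"
    by (simp add: measure_measure_pmf_finite)
  also have "\<dots> \<le> measure_pmf.prob (binomial_mean_pmf n a) {a<..}"
    by (intro measure_pmf.finite_measure_mono) auto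
  finally show ?thesis .
qed

lemma prob_binomial_mean_one_greaterThan_ge:
  assumes "2 \<le> n"
  shows "2 / 9 \<le> measure_pmf.prob (binomial_mean_pmf n 1) {1<..}" (is "_ \<le> ?tail")
proof (cases "n = 2")
  case True
  have "2 / 9 \<le> pmf (binomial_mean_pmf 2 1) 2"
    by (simp add: binomial_mean_pmf_def power2_eq_square)
  also have "\<dots> = measure_pmf.prob (binomial_mean_pmf n 1) {2}"
    by (simp add: True measure_pmf_single)
  also have "\<dots> \<le> ?tail"
    by (intro measure_pmf.finite_measure_mono) auto
  finally show ?thesis .
next
  case False
  let ?b = "pmf (binomial_mean_pmf n 1)"
  have "?b 0 + ?b 1 + ?tail = 1"
  proof -
    have "UNIV - {0, 1} = {1::nat<..}"
      by auto
    then show ?thesis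
      using measure_pmf.prob_compl[of "{0, 1}" "binomial_mean_pmf n 1"]
      by (simp add: measure_measure_pmf_finite)
  qed
  moreover have "?b 0 \<le> ?b 1"
    using pmf_binomial_mean_reflect_le[of 1 n 0] assms by simp
  moreover have "?b 1 * (7 / 12) \<le> ?tail"
  proof -
    have "1 / real (n - 1) \<le> 1 / 2"
      using False assms by (intro divide_left_mono) auto
    then have "?b 1 * (1 / 2 * (1 + 1 / 3 * (1 / 2)))
        \<le> ?b 1 * (1 / 2 * (1 + 1 / 3 * (1 - 1 / real (n - 1))))"
      by (intro mult_left_mono add_left_mono) auto
    also have "\<dots> \<le> ?tail"
      using prob_binomial_mean_greaterThan_ge_pmf[of 1 n] assms by simp
    finally show ?thesis
      by simp
  qed
  ultimately show ?thesis
    by linarith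
qed

lemma prob_binomial_mean_greaterThan_ge:
  assumes "0 < a" "2 * a \<le> n"
  shows "2 / 9 \<le> measure_pmf.prob (binomial_mean_pmf n a) {a<..}" (is "_ \<le> ?tail")
proof (cases "a = 1")
  case True
  then show ?thesis
    using assms prob_binomial_mean_one_greaterThan_ge[of n] by simp
next
  case False
  let ?b = "pmf (binomial_mean_pmf n a)"
  have "?b a + ?tail = measure_pmf.prob (binomial_mean_pmf n a) ({a} \<union> {a<..})"
    by (subst measure_pmf.finite_measure_Union) (auto simp: measure_pmf_single)
  also have "{a} \<union> {a<..} = {a..}"
    by auto
  finally have "1 / 2 \<le> ?b a + ?tail"
    using prob_binomial_mean_atLeast_ge[OF assms(2)] by simp
  moreover have "?b a * (5 / 6) \<le> ?tail"
  proof -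
    have "1 / real (n - a) \<le> 1 / 2"
      using False assms by (intro divide_left_mono) auto
    moreover have "2 / 3 \<le> a / (a + 1)" "1 / 2 \<le> a / (a + 2)"
      using False assms(1) by (auto simp: field_simps)
    ultimately have "?b a * (2 / 3) * (1 + 1 / 2 * (1 / 2))
        \<le> ?b a * (a / (a + 1)) * (1 + a / (a + 2) * (1 - 1 / real (n - a)))"
      by (intro mult_mono add_left_mono) auto
    also have "\<dots> \<le> ?tail"
      using assms by (intro prob_binomial_mean_greaterThan_ge_pmf) auto
    finally show ?thesis
      by simp
  qed
  ultimately show ?thesis
    by linarith
qed

definition tilt_exponent :: "real \<Rightarrow> nat \<Rightarrow> real" where
  "tilt_exponent \<delta> a = inverse (1 - \<delta>) * \<delta>\<^sup>2 * real a"

lemma chi_square_binomial_mean_le: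
  fixes \<delta> :: real
  assumes "0 < a" "2 \<le> m" "\<delta> < 1" "real n = (1 - \<delta>) * real (a * m)"
  defines "p \<equiv> 1 / real m" and "r \<equiv> real a / real n"
  shows "(1 + (r - p)\<^sup>2 / (p * (1 - p))) ^ n \<le> exp (2 * tilt_exponent \<delta> a)"
proof -
  let ?x = "(r - p)\<^sup>2 / (p * (1 - p))"
  have p_range: "0 < p" "p \<le> 1 / 2"
    using assms(2) by (auto simp: p_def field_simps)
  have expected_load: "real n * p = (1 - \<delta>) * real a"
    using assms by (simp add: p_def field_simps)
  have "r = p / (1 - \<delta>)"
    using assms by (simp add: p_def r_def)
  then have "r - p = p * \<delta> / (1 - \<delta>)"
    using assms(3) by (simp add: field_simps)
  then have "real n * ?x = (real n * p) * \<delta>\<^sup>2 / ((1 - \<delta>)\<^sup>2 * (1 - p))"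
    using p_range by (simp add: power_divide power_mult_distrib power2_eq_square mult_ac)
  also have "\<dots> = tilt_exponent \<delta> a * (1 / (1 - p))"
    unfolding expected_load tilt_exponent_def using assms(3) p_range
    by (simp add: power2_eq_square divide_simps)
  also have "\<dots> \<le> tilt_exponent \<delta> a * 2"
    using p_range assms(3) by (intro mult_left_mono) (auto simp: tilt_exponent_def field_simps)
  finally have exponent_le: "real n * ?x \<le> 2 * tilt_exponent \<delta> a"
    by simp
  have "(1 + ?x) ^ n \<le> exp ?x ^ n"
    using p_range by (intro power_mono exp_ge_add_one_self) auto
  also have "\<dots> = exp (real n * ?x)"
    by (rule exp_of_nat_mult[symmetric])
  finally show ?thesis
    using exponent_le by (meson exp_le_cancel_iff order.trans)
qed

lemma prob_binomial_pmf_greaterThan_ge: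
  fixes \<delta> :: real
  assumes capacity: "0 < a" "2 * a \<le> n" and buckets: "2 \<le> m"
    and mean_load: "\<delta> < 1" "real n = (1 - \<delta>) * real (a * m)"
  shows "4 / 81 * exp (- 2 * tilt_exponent \<delta> a)
    \<le> measure_pmf.prob (binomial_pmf n (1 / real m)) {a<..}" (is "_ \<le> ?tail")
proof -
  have "(2 / 9)\<^sup>2 \<le> (measure_pmf.prob (binomial_mean_pmf n a) {a<..})\<^sup>2"
    by (intro power_mono prob_binomial_mean_greaterThan_ge capacity) auto
  also have "\<dots> \<le> ?tail * (1 + (a / n - 1 / m)\<^sup>2 / (1 / m * (1 - 1 / m))) ^ n"
    unfolding binomial_mean_pmf_def
    by (intro prob_binomial_pmf_square_le) (use capacity buckets in auto)
  also have "\<dots> \<le> ?tail * exp (2 * tilt_exponent \<delta> a)"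
    by (intro mult_left_mono chi_square_binomial_mean_le[OF capacity(1) buckets mean_load]) auto
  finally show ?thesis
    by (simp add: exp_minus power2_eq_square field_simps)
qed

section \<open>Cyclic request sequences\<close>

lemma misses_Nil [simp]: "misses f [] = 0"
  by (simp add: misses_def)

lemma misses_snoc: "misses f (\<sigma> @ [x]) = misses f \<sigma> + of_bool (x \<notin> f \<sigma>)"
proof -
  have "{i. i < length (\<sigma> @ [x]) \<and> (\<sigma> @ [x]) ! i \<notin> f (take i (\<sigma> @ [x]))}
      = {i. i < length \<sigma> \<and> \<sigma> ! i \<notin> f (take i \<sigma>)} \<union> (if x \<notin> f \<sigma> then {length \<sigma>} else {})"
    by (auto simp: nth_append less_Suc_eq)
  then show ?thesis
    by (simp add: misses_def)
qed

lemma misses_append_mono: "misses f \<rho> \<le> misses f (\<rho> @ \<tau>)"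
proof (induction \<tau> rule: rev_induct)
  case (snoc x \<tau>)
  then show ?case
    using misses_snoc[of f "\<rho> @ \<tau>" x] by simp
qed simp

lemma paging_cache_append_subset:
  assumes "paging_algorithm A" "0 < k"
  shows "A k (\<rho> @ \<tau>) \<subseteq> A k \<rho> \<union> set \<tau>"
proof (induction \<tau> rule: rev_induct)
  case (snoc x \<tau>)
  have "A k ((\<rho> @ \<tau>) @ [x]) \<subseteq> insert x (A k (\<rho> @ \<tau>))"
    using assms unfolding paging_algorithm_def by blast
  with snoc show ?case
    by auto
qed simp

lemma paging_cache_subset:
  assumes "paging_algorithm A" "0 < k"
  shows "A k \<tau> \<subseteq> set \<tau>"
  using paging_cache_append_subset[OF assms, of "[]" \<tau>] assms by (auto simp: paging_algorithm_def)

lemma misses_less_append_overfull: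
  assumes paging: "paging_algorithm A" "0 < k" and overfull: "distinct \<tau>" "k < length \<tau>"
  shows "misses (A k) \<rho> < misses (A k) (\<rho> @ \<tau>)"
proof -
  have "finite (A k \<rho>)" "card (A k \<rho>) \<le> k"
    using paging by (auto simp: paging_algorithm_def)
  then have "\<not> set \<tau> \<subseteq> A k \<rho>"
    using overfull card_mono[of "A k \<rho>" "set \<tau>"] by (auto simp: distinct_card)
  then obtain x where uncached: "x \<in> set \<tau>" "x \<notin> A k \<rho>"
    by blast
  then obtain \<tau>\<^sub>1 \<tau>\<^sub>2 where split: "\<tau> = \<tau>\<^sub>1 @ x # \<tau>\<^sub>2"
    by (meson split_list)
  then have "x \<notin> A k (\<rho> @ \<tau>\<^sub>1)"
    using uncached(2) overfull(1) paging_cache_append_subset[OF paging, of \<rho> \<tau>\<^sub>1] by auto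
  then have "misses (A k) (\<rho> @ \<tau>\<^sub>1) < misses (A k) ((\<rho> @ \<tau>\<^sub>1) @ [x])"
    using misses_snoc[of "A k" "\<rho> @ \<tau>\<^sub>1" x] by simp
  also have "\<dots> \<le> misses (A k) (\<rho> @ \<tau>)"
    using misses_append_mono[of "A k" "\<rho> @ \<tau>\<^sub>1 @ [x]" \<tau>\<^sub>2] by (simp add: split)
  finally show ?thesis
    using misses_append_mono[of "A k" \<rho> \<tau>\<^sub>1] by simp
qed

lemma misses_append_replicate_overfull:
  assumes "paging_algorithm A" "0 < k" "distinct \<tau>" "k < length \<tau>"
  shows "misses (A k) \<rho> + R \<le> misses (A k) (\<rho> @ concat (replicate R \<tau>))"
proof (induction R)
  case (Suc R)
  have "concat (replicate (Suc R) \<tau>) = concat (replicate R \<tau>) @ \<tau>"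
    by (simp flip: replicate_append_same)
  then show ?case
    using Suc misses_less_append_overfull[OF assms, of "\<rho> @ concat (replicate R \<tau>)"] by simp
qed simp

definition cycle_blocks :: "nat \<Rightarrow> 'u list list \<Rightarrow> 'u list" where
  "cycle_blocks R \<tau>s = concat (map (\<lambda>\<tau>. concat (replicate R \<tau>)) \<tau>s)"

lemma cycle_blocks_append: "cycle_blocks R (\<tau>s @ \<tau>s') = cycle_blocks R \<tau>s @ cycle_blocks R \<tau>s'"
  by (simp add: cycle_blocks_def)

lemma set_cycle_blocks: "set (cycle_blocks R \<tau>s) \<subseteq> set (concat \<tau>s)"
  by (auto simp: cycle_blocks_def)

lemma length_cycle_blocks: "length (cycle_blocks R \<tau>s) = R * length (concat \<tau>s)"
proof (induction \<tau>s)
  case (Cons \<tau> \<tau>s)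
  have "length (concat (replicate R \<tau>)) = R * length \<tau>"
    by (induction R) simp_all
  with Cons show ?case
    by (simp add: cycle_blocks_def distrib_left)
qed (simp add: cycle_blocks_def)

lemma filter_cycle_blocks: "filter P (cycle_blocks R \<tau>s) = cycle_blocks R (map (filter P) \<tau>s)"
  unfolding cycle_blocks_def by (simp only: filter_concat map_map comp_def map_replicate)

lemma misses_cycle_blocks_conservative_le:
  assumes "conservative A" "0 < k" and "\<And>\<tau>. \<tau> \<in> set \<tau>s \<Longrightarrow> card (set \<tau>) \<le> k"
  shows "misses (A k) (cycle_blocks R \<tau>s) \<le> length \<tau>s * k"
  using assms(3)
proof (induction \<tau>s rule: rev_induct)
  case (snoc \<tau> \<tau>s)
  have "card (set (cycle_blocks R [\<tau>])) \<le> card (set \<tau>)"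
    using set_cycle_blocks[of R "[\<tau>]"] by (intro card_mono) auto
  also have "\<dots> \<le> k"
    using snoc.prems by simp
  finally have "misses (A k) (cycle_blocks R \<tau>s @ cycle_blocks R [\<tau>])
      \<le> misses (A k) (cycle_blocks R \<tau>s) + k"
    using assms(1,2) unfolding conservative_def by blast
  with snoc show ?case
    by (simp add: cycle_blocks_append)
qed (simp add: cycle_blocks_def)

lemma misses_cycle_blocks_overfull_ge:
  assumes paging: "paging_algorithm A" "0 < k" and overfull: "\<tau> \<in> set \<tau>s" "distinct \<tau>" "k < length \<tau>"
  shows "R \<le> misses (A k) (cycle_blocks R \<tau>s)"
proof -
  obtain \<tau>s\<^sub>1 \<tau>s\<^sub>2 where "\<tau>s = \<tau>s\<^sub>1 @ \<tau> # \<tau>s\<^sub>2"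
    using overfull(1) by (meson split_list)
  then have "cycle_blocks R \<tau>s
      = (cycle_blocks R \<tau>s\<^sub>1 @ concat (replicate R \<tau>)) @ cycle_blocks R \<tau>s\<^sub>2"
    by (simp add: cycle_blocks_def)
  moreover have "R \<le> misses (A k) (cycle_blocks R \<tau>s\<^sub>1 @ concat (replicate R \<tau>))"
    using misses_append_replicate_overfull[OF paging overfull(2,3), of "cycle_blocks R \<tau>s\<^sub>1" R] by simp
  ultimately show ?thesis
    using misses_append_mono order.trans by metis
qed

lemma misses_set_associative:
  assumes paging: "paging_algorithm A" "0 < a" and hash_range: "h \<in> set \<sigma> \<rightarrow> {..<k div a}"
  shows "misses (set_associative A a k h) \<sigma> = (\<Sum>b<k div a. misses (A a) (filter (\<lambda>x. h x = b) \<sigma>))"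
  using hash_range
proof (induction \<sigma> rule: rev_induct)
  case (snoc x \<sigma>)
  let ?requests = "\<lambda>b. filter (\<lambda>x. h x = b) \<sigma>"
  have bucket_range: "h x < k div a"
    using snoc.prems by simp
  have "x \<in> set_associative A a k h \<sigma> \<longleftrightarrow> x \<in> A a (?requests (h x))"
    using bucket_range paging_cache_subset[OF paging, of "?requests _"]
    by (fastforce simp: set_associative_def)
  moreover have "(\<Sum>b<k div a. misses (A a) (filter (\<lambda>x. h x = b) (\<sigma> @ [x])))
      = (\<Sum>b<k div a. misses (A a) (?requests b)
          + (if b = h x then of_bool (x \<notin> A a (?requests (h x))) else 0))"
    by (intro sum.cong) (auto simp: misses_snoc)
  ultimately show ?case
    using snoc bucket_range by (simp add: misses_snoc sum.distrib)
qed simp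

definition bucket_load :: "('u \<Rightarrow> nat) \<Rightarrow> nat \<Rightarrow> 'u set \<Rightarrow> nat" where
  "bucket_load h b S = card {x \<in> S. h x = b}"

definition overloaded_buckets :: "nat \<Rightarrow> nat \<Rightarrow> ('u \<Rightarrow> nat) \<Rightarrow> 'u set set \<Rightarrow> nat set" where
  "overloaded_buckets a m h \<S> = {b. b < m \<and> (\<exists>S\<in>\<S>. a < bucket_load h b S)}"

lemma misses_set_associative_cycle_blocks_ge:
  assumes paging: "paging_algorithm A" "0 < a"
    and distinct_blocks: "\<And>\<tau>. \<tau> \<in> set \<tau>s \<Longrightarrow> distinct \<tau>"
    and hash_range: "h \<in> set (concat \<tau>s) \<rightarrow> {..<k div a}"
  shows "R * card (overloaded_buckets a (k div a) h (set ` set \<tau>s))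
    \<le> misses (set_associative A a k h) (cycle_blocks R \<tau>s)"
proof -
  let ?B = "overloaded_buckets a (k div a) h (set ` set \<tau>s)"
  let ?misses = "\<lambda>b. misses (A a) (filter (\<lambda>x. h x = b) (cycle_blocks R \<tau>s))"
  have "R \<le> ?misses b" if bucket_overloaded: "b \<in> ?B" for b
  proof -
    obtain \<tau> where overfull: "\<tau> \<in> set \<tau>s" "a < bucket_load h b (set \<tau>)"
      using bucket_overloaded unfolding overloaded_buckets_def by blast
    let ?\<tau> = "filter (\<lambda>x. h x = b) \<tau>"
    have "distinct ?\<tau>"
      using overfull distinct_blocks by simp
    moreover from this have "a < length ?\<tau>"
      using overfull(2) distinct_card[of ?\<tau>] by (simp add: bucket_load_def)
    ultimately show ?thesis
      unfolding filter_cycle_blocks using paging overfull(1) by (intro misses_cycle_blocks_overfull_ge) auto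
  qed
  then have "R * card ?B \<le> (\<Sum>b\<in>?B. ?misses b)"
    using sum_bounded_below[of ?B R] by (simp add: mult.commute)
  also have "\<dots> \<le> (\<Sum>b<k div a. ?misses b)"
    by (intro sum_mono2) (auto simp: overloaded_buckets_def)
  also have "\<dots> = misses (set_associative A a k h) (cycle_blocks R \<tau>s)"
    using set_cycle_blocks[of R \<tau>s] hash_range by (intro misses_set_associative[symmetric] paging) blast
  finally show ?thesis .
qed

lemma ex_concat_eq_equal_length:
  "length xs = N * n \<Longrightarrow> \<exists>\<tau>s. concat \<tau>s = xs \<and> length \<tau>s = N \<and> (\<forall>\<tau>\<in>set \<tau>s. length \<tau> = n)"
proof (induction N arbitrary: xs)
  case (Suc N)
  then obtain \<tau>s where "concat \<tau>s = drop n xs" "length \<tau>s = N" "\<forall>\<tau>\<in>set \<tau>s. length \<tau> = n"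
    by (metis add_diff_cancel_left' length_drop mult_Suc)
  then show ?case
    using Suc.prems by (intro exI[of _ "take n xs # \<tau>s"]) auto
qed simp

lemma obtain_disjoint_lists:
  assumes "infinite U \<or> N * n \<le> card U"
  obtains \<tau>s where "length \<tau>s = N" "\<And>\<tau>. \<tau> \<in> set \<tau>s \<Longrightarrow> length \<tau> = n"
    "distinct (concat \<tau>s)" "set (concat \<tau>s) \<subseteq> U"
proof -
  obtain W where "W \<subseteq> U" "finite W" "card W = N * n"
    using assms obtain_subset_with_card_n infinite_arbitrarily_large by metis
  then obtain xs where "set xs \<subseteq> U" "distinct xs" "length xs = N * n"
    by (metis distinct_card finite_distinct_list)
  then show ?thesis
    using that ex_concat_eq_equal_length by metis
qed

section \<open>Random bucket loads\<close>

lemma indep_vars_PiM_component: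
  assumes components: "\<And>i. i \<in> I \<Longrightarrow> prob_space (M i)"
  shows "prob_space.indep_vars (PiM I M) M (\<lambda>i \<omega>. \<omega> i) I"
proof -
  interpret prob_space "PiM I M"
    using components by (rule prob_space_PiM)
  show ?thesis
  proof (cases "I = {}")
    case False
    have "distr (PiM I M) (PiM I M) (\<lambda>\<omega>. \<lambda>i\<in>I. \<omega> i) = distr (PiM I M) (PiM I M) (\<lambda>\<omega>. \<omega>)"
      by (intro distr_cong) (auto simp: space_PiM)
    also have "\<dots> = PiM I (\<lambda>i. distr (PiM I M) (M i) (\<lambda>\<omega>. \<omega> i))"
      using components by (auto intro!: PiM_cong simp: distr_PiM_component)
    finally show ?thesis
      using False by (subst indep_vars_iff_distr_eq_PiM') auto
  qed (unfold indep_vars_def indep_sets_def, blast)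
qed

lemma measurable_Collect_Pow:
  assumes "finite I" and preds: "\<And>i. i \<in> I \<Longrightarrow> Measurable.pred M (X i)"
  shows "(\<lambda>\<omega>. {i \<in> I. X i \<omega>}) \<in> measurable M (count_space (Pow I))"
proof -
  have "(\<lambda>\<omega>. {i \<in> I. X i \<omega>}) -` {B} \<inter> space M \<in> sets M" if "B \<subseteq> I" for B
  proof -
    have "(\<lambda>\<omega>. {i \<in> I. X i \<omega>}) -` {B} \<inter> space M = {\<omega> \<in> space M. \<forall>i\<in>I. X i \<omega> \<longleftrightarrow> i \<in> B}"
      using that by auto
    also have "\<dots> \<in> sets M"
      using assms by measurable
    finally show ?thesis .
  qed
  then show ?thesis
    using assms(1) by (auto simp: measurable_count_space_eq2)
qed

lemma measurable_card_Collect: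
  assumes "finite I" "\<And>i. i \<in> I \<Longrightarrow> Measurable.pred M (X i)"
  shows "(\<lambda>\<omega>. card {i \<in> I. X i \<omega>}) \<in> measurable M (count_space UNIV)"
  by (rule measurable_compose[OF measurable_Collect_Pow[OF assms]]) auto

lemma (in prob_space) prob_bernoulli_pattern:
  assumes index: "finite I" "B \<subseteq> I" and indep: "indep_vars (\<lambda>_. count_space UNIV) X I"
    and bias: "\<And>i. i \<in> I \<Longrightarrow> prob {\<omega> \<in> space M. X i \<omega>} = p"
  shows "prob {\<omega> \<in> space M. {i \<in> I. X i \<omega>} = B} = p ^ card B * (1 - p) ^ (card I - card B)"
proof (cases "I = {}")
  case True
  with index show ?thesis
    by (simp add: prob_space)
next
  case False
  have X_measurable: "X i \<in> measurable M (count_space UNIV)" if "i \<in> I" for i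
    using indep that by (auto simp: indep_vars_def)
  have component: "prob (X i -` {i \<in> B} \<inter> space M) = (if i \<in> B then p else 1 - p)" if "i \<in> I" for i
  proof -
    have "prob (X i -` {True} \<inter> space M) = p"
      using bias[OF that] by (simp add: vimage_def Int_def conj_commute)
    moreover have "X i -` {False} \<inter> space M = space M - (X i -` {True} \<inter> space M)"
      by auto
    ultimately show ?thesis
      using X_measurable[OF that] by (simp add: prob_compl measurable_sets)
  qed
  have "{\<omega> \<in> space M. {i \<in> I. X i \<omega>} = B} = (\<Inter>i\<in>I. X i -` {i \<in> B} \<inter> space M)"
    using False index(2) by auto
  then have "prob {\<omega> \<in> space M. {i \<in> I. X i \<omega>} = B} = (\<Prod>i\<in>I. prob (X i -` {i \<in> B} \<inter> space M))"
    using indep_varsD_finite[OF indep False index(1), of "\<lambda>i. {i \<in> B}"] by simp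
  also have "\<dots> = (\<Prod>i\<in>I. if i \<in> B then p else 1 - p)"
    using component by (intro prod.cong) auto
  also have "\<dots> = p ^ card B * (1 - p) ^ card (I - B)"
    using index by (simp add: prod.If_cases Int_absorb1 flip: Diff_eq)
  finally show ?thesis
    using index by (simp add: card_Diff_subset finite_subset)
qed

lemma (in prob_space) distr_card_indep_bernoulli:
  assumes finite_index: "finite I" and indep: "indep_vars (\<lambda>_. count_space UNIV) X I"
    and bias: "0 \<le> p" "p \<le> 1" "\<And>i. i \<in> I \<Longrightarrow> prob {\<omega> \<in> space M. X i \<omega>} = p"
  shows "distr M (count_space UNIV) (\<lambda>\<omega>. card {i \<in> I. X i \<omega>}) = binomial_pmf (card I) p"
proof (rule measure_eqI_countable[of _ UNIV])
  have X_measurable: "Measurable.pred M (X i)" if "i \<in> I" for i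
    using indep that by (auto simp: indep_vars_def)
  have pattern: "{\<omega> \<in> space M. {i \<in> I. X i \<omega>} = B} \<in> events" if "B \<subseteq> I" for B
    using measurable_sets[OF measurable_Collect_Pow[OF finite_index X_measurable], where S = "{B}"] that
    by (simp add: vimage_def Int_def conj_commute)
  note [measurable] = measurable_card_Collect[OF finite_index X_measurable]
  fix j
  have "{\<omega> \<in> space M. card {i \<in> I. X i \<omega>} = j}
      = (\<Union>B\<in>{B. B \<subseteq> I \<and> card B = j}. {\<omega> \<in> space M. {i \<in> I. X i \<omega>} = B})"
    by auto
  also have "prob \<dots> = (\<Sum>B | B \<subseteq> I \<and> card B = j. prob {\<omega> \<in> space M. {i \<in> I. X i \<omega>} = B})"
    using finite_index pattern by (intro finite_measure_finite_Union) (auto simp: disjoint_family_on_def)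
  also have "\<dots> = (\<Sum>B | B \<subseteq> I \<and> card B = j. p ^ j * (1 - p) ^ (card I - j))"
    using prob_bernoulli_pattern[OF finite_index _ indep bias(3)] by (intro sum.cong) auto
  also have "\<dots> = pmf (binomial_pmf (card I) p) j"
    using n_subsets[OF finite_index, of j] bias by simp
  finally have "prob {\<omega> \<in> space M. card {i \<in> I. X i \<omega>} = j} = pmf (binomial_pmf (card I) p) j" .
  then show "emeasure (distr M (count_space UNIV) (\<lambda>\<omega>. card {i \<in> I. X i \<omega>})) {j}
      = emeasure (binomial_pmf (card I) p) {j}"
    by (simp add: emeasure_distr emeasure_pmf_single emeasure_eq_measure
        vimage_def Int_def conj_commute)
qed auto

lemma (in prob_space) prob_card_events_ge_le:
  assumes events_family: "finite B" "\<And>b. b \<in> B \<Longrightarrow> E b \<in> events" and threshold_pos: "0 < t"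
  shows "{\<omega> \<in> space M. t \<le> real (card {b \<in> B. \<omega> \<in> E b})} \<in> events"
    and "prob {\<omega> \<in> space M. t \<le> real (card {b \<in> B. \<omega> \<in> E b})} \<le> (\<Sum>b\<in>B. prob (E b)) / t"
proof -
  let ?Z = "\<lambda>\<omega>. \<Sum>b\<in>B. indicator (E b) \<omega> :: real"
  have card_eq: "real (card {b \<in> B. \<omega> \<in> E b}) = ?Z \<omega>" for \<omega>
    using events_family(1) by (simp add: indicator_def sum.If_cases Int_def)
  have integrable_count: "integrable M ?Z"
    using events_family by (intro Bochner_Integration.integrable_sum) (simp add: emeasure_eq_measure)
  show "{\<omega> \<in> space M. t \<le> real (card {b \<in> B. \<omega> \<in> E b})} \<in> events"
    unfolding card_eq using borel_measurable_integrable[OF integrable_count] by measurable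
  have "prob {\<omega> \<in> space M. t \<le> ?Z \<omega>} \<le> expectation ?Z / t"
    by (rule integral_Markov_inequality_measure[OF integrable_count, where A = "{}"])
       (use threshold_pos in \<open>auto simp: sum_nonneg\<close>)
  also have "expectation ?Z = (\<Sum>b\<in>B. prob (E b))"
    using events_family by (subst Bochner_Integration.integral_sum) (auto simp: emeasure_eq_measure)
  finally show "prob {\<omega> \<in> space M. t \<le> real (card {b \<in> B. \<omega> \<in> E b})} \<le> (\<Sum>b\<in>B. prob (E b)) / t"
    unfolding card_eq .
qed

lemma prob_space_random_hash: "0 < m \<Longrightarrow> prob_space (random_hash U m)"
  unfolding random_hash_def
  by (intro prob_space_PiM prob_space_uniform_count_measure) (auto simp: lessThan_empty_iff)

lemma space_random_hash: "space (random_hash U m) = U \<rightarrow>\<^sub>E {..<m}"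
  by (simp add: random_hash_def space_PiM space_uniform_count_measure)

lemma indep_vars_random_hash:
  assumes "0 < m"
  shows "prob_space.indep_vars (random_hash U m) (\<lambda>_. uniform_count_measure {..<m}) (\<lambda>x h. h x) U"
  unfolding random_hash_def using assms
  by (intro indep_vars_PiM_component prob_space_uniform_count_measure) (auto simp: lessThan_empty_iff)

lemma measurable_hash_eq:
  assumes "x \<in> U"
  shows "Measurable.pred (random_hash U m) (\<lambda>h. h x = b)"
  unfolding random_hash_def
  by (rule measurable_compose[OF measurable_component_singleton[OF assms]])
     (auto simp: measurable_cong_sets[OF sets_uniform_count_measure_count_space])

lemma prob_hash_eq:
  assumes "b < m" "x \<in> U"
  shows "measure (random_hash U m) {h \<in> space (random_hash U m). h x = b} = 1 / real m"
proof -
  let ?u = "uniform_count_measure {..<m}"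
  have prob_space_uniform: "prob_space ?u"
    using assms(1) by (intro prob_space_uniform_count_measure) (auto simp: lessThan_empty_iff)
  have "measure (random_hash U m) {h \<in> space (random_hash U m). h x = b}
      = measure (distr (random_hash U m) ?u (\<lambda>h. h x)) {b}"
    using assms by (subst measure_distr)
      (auto simp: random_hash_def sets_uniform_count_measure vimage_def Int_def conj_commute)
  also have "distr (random_hash U m) ?u (\<lambda>h. h x) = ?u"
    unfolding random_hash_def using prob_space_uniform assms(2) by (rule distr_PiM_component)
  finally show ?thesis
    using assms(1) by (simp add: measure_uniform_count_measure)
qed

lemma measurable_bucket_load:
  assumes "finite S" "S \<subseteq> U"
  shows "(\<lambda>h. bucket_load h b S) \<in> measurable (random_hash U m) (count_space UNIV)"
  unfolding bucket_load_def using assms by (intro measurable_card_Collect measurable_hash_eq) auto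

lemma distr_bucket_load:
  assumes "b < m" "finite S" "S \<subseteq> U"
  shows "distr (random_hash U m) (count_space UNIV) (\<lambda>h. bucket_load h b S)
    = binomial_pmf (card S) (1 / real m)"
proof -
  interpret prob_space "random_hash U m"
    using assms(1) by (intro prob_space_random_hash) simp
  have "indep_vars (\<lambda>_. count_space UNIV) (\<lambda>x h. h x = b) S"
  proof (rule indep_vars_compose2[where X = "\<lambda>x h. h x" and Y = "\<lambda>_ y. y = b"])
    show "indep_vars (\<lambda>_. uniform_count_measure {..<m}) (\<lambda>x h. h x) S"
      using assms(1) by (intro indep_vars_subset[OF indep_vars_random_hash assms(3)]) simp
  qed (simp add: measurable_cong_sets[OF sets_uniform_count_measure_count_space refl])
  then show ?thesis
    unfolding bucket_load_def using assms
    by (intro distr_card_indep_bernoulli prob_hash_eq) auto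
qed

lemma prob_bucket_load_atMost:
  assumes "b < m" "finite S" "S \<subseteq> U"
  shows "measure (random_hash U m) ((\<lambda>h. bucket_load h b S) -` {..a} \<inter> space (random_hash U m))
    = measure_pmf.prob (binomial_pmf (card S) (1 / real m)) {..a}"
  using measure_distr[OF measurable_bucket_load[OF assms(2,3)], of "{..a}" m b]
  by (simp add: distr_bucket_load[OF assms])

lemma indep_vars_bucket_load:
  fixes S :: "'i \<Rightarrow> 'u set"
  assumes m_pos: "0 < m" and item_sets: "\<And>i. i \<in> I \<Longrightarrow> finite (S i)" "\<And>i. i \<in> I \<Longrightarrow> S i \<subseteq> U"
    and disjoint: "disjoint_family_on S I"
  shows "prob_space.indep_vars (random_hash U m) (\<lambda>_. count_space UNIV)
    (\<lambda>i h. bucket_load h b (S i)) I"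
proof -
  interpret prob_space "random_hash U m"
    using m_pos by (rule prob_space_random_hash)
  have "indep_vars (\<lambda>_. count_space UNIV) (\<lambda>i h. bucket_load (restrict h (S i)) b (S i)) I"
  proof (rule indep_vars_compose2[OF indep_vars_restrict[OF indep_vars_random_hash[OF m_pos] _ disjoint]])
    show "(\<lambda>h. bucket_load h b (S i))
        \<in> measurable (PiM (S i) (\<lambda>_. uniform_count_measure {..<m})) (count_space UNIV)" if "i \<in> I" for i
      using measurable_bucket_load[OF item_sets(1)[OF that] subset_refl] by (simp only: random_hash_def)
  qed (rule item_sets(2))
  moreover have "bucket_load (restrict h T) b T = bucket_load h b T" for h :: "'u \<Rightarrow> nat" and T
    by (auto simp: bucket_load_def intro!: arg_cong[where f = card])
  ultimately show ?thesis
    by (simp only:)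
qed

definition never_overloading_hashes ::
  "'u set \<Rightarrow> nat \<Rightarrow> nat \<Rightarrow> 'u set set \<Rightarrow> nat \<Rightarrow> ('u \<Rightarrow> nat) set" where
  "never_overloading_hashes U m a \<S> b = {h \<in> space (random_hash U m). b \<notin> overloaded_buckets a m h \<S>}"

lemma never_overloading_hashes_eq:
  "b < m \<Longrightarrow> never_overloading_hashes U m a \<S> b
    = {h \<in> space (random_hash U m). \<forall>S\<in>\<S>. bucket_load h b S \<le> a}"
  by (auto simp: never_overloading_hashes_def overloaded_buckets_def not_less)

lemma sets_never_overloading_hashes:
  assumes "b < m" "finite \<S>" and block_sets: "\<And>S. S \<in> \<S> \<Longrightarrow> finite S \<and> S \<subseteq> U"
  shows "never_overloading_hashes U m a \<S> b \<in> sets (random_hash U m)"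
proof -
  have [measurable]: "(\<lambda>h. bucket_load h b S) \<in> measurable (random_hash U m) (count_space UNIV)"
    if "S \<in> \<S>" for S
    using block_sets[OF that] by (intro measurable_bucket_load) auto
  show ?thesis
    unfolding never_overloading_hashes_eq[OF assms(1)] using assms(2) by measurable
qed

lemma prob_never_overloading_hashes:
  assumes b_less: "b < m" and disjoint_family: "finite \<S>" "disjoint \<S>"
    and block_sets: "\<And>S. S \<in> \<S> \<Longrightarrow> finite S \<and> card S = n \<and> S \<subseteq> U"
  shows "measure (random_hash U m) (never_overloading_hashes U m a \<S> b)
    = measure_pmf.prob (binomial_pmf n (1 / real m)) {..a} ^ card \<S>"
proof -
  interpret prob_space "random_hash U m"
    using b_less by (intro prob_space_random_hash) simp
  show ?thesis
  proof (cases "\<S> = {}")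
    case True
    then show ?thesis
      using b_less by (simp add: never_overloading_hashes_eq prob_space)
  next
    case False
    let ?within = "\<lambda>S. (\<lambda>h. bucket_load h b S) -` {..a} \<inter> space (random_hash U m)"
    have indep: "indep_vars (\<lambda>_. count_space UNIV) (\<lambda>S h. bucket_load h b S) \<S>"
      using b_less block_sets disjoint_family(2)
      by (intro indep_vars_bucket_load) (auto simp: disjoint_family_on_def disjoint_def)
    have "never_overloading_hashes U m a \<S> b = (\<Inter>S\<in>\<S>. ?within S)"
      using False b_less by (auto simp: never_overloading_hashes_eq)
    then have "prob (never_overloading_hashes U m a \<S> b) = (\<Prod>S\<in>\<S>. prob (?within S))"
      using indep_varsD_finite[OF indep False disjoint_family(1), of "\<lambda>_. {..a}"] by simp
    also have "\<dots> = (\<Prod>S\<in>\<S>. measure_pmf.prob (binomial_pmf n (1 / real m)) {..a})"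
    proof (intro prod.cong refl)
      fix S assume "S \<in> \<S>"
      from block_sets[OF this] show "prob (?within S) = measure_pmf.prob (binomial_pmf n (1 / real m)) {..a}"
        using prob_bucket_load_atMost[OF b_less, of S U] by simp
    qed
    finally show ?thesis
      by simp
  qed
qed

lemma card_never_overloaded:
  assumes "h \<in> space (random_hash U m)"
  shows "real (card {b \<in> {..<m}. h \<in> never_overloading_hashes U m a \<S> b})
    = real m - real (card (overloaded_buckets a m h \<S>))"
proof -
  let ?B = "overloaded_buckets a m h \<S>"
  have subset: "?B \<subseteq> {..<m}"
    by (auto simp: overloaded_buckets_def)
  have "{b \<in> {..<m}. h \<in> never_overloading_hashes U m a \<S> b} = {..<m} - ?B"
    using assms by (auto simp: never_overloading_hashes_def)
  then have "card {b \<in> {..<m}. h \<in> never_overloading_hashes U m a \<S> b} = m - card ?B"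
    using card_Diff_subset[OF finite_subset[OF subset finite_lessThan] subset] by (simp only: card_lessThan)
  moreover have "card ?B \<le> m"
    using card_mono[OF finite_lessThan subset] by simp
  ultimately show ?thesis
    by (simp only: of_nat_diff)
qed

lemma prob_few_overloaded_buckets_le:
  fixes \<S> :: "'u set set" and \<theta> :: real and a :: nat
  assumes m_pos: "0 < m" and disjoint_family: "finite \<S>" "disjoint \<S>"
    and block_sets: "\<And>S. S \<in> \<S> \<Longrightarrow> finite S \<and> card S = n \<and> S \<subseteq> U" and fraction_less: "\<theta> < 1"
  defines "few \<equiv> {h \<in> space (random_hash U m). real (card (overloaded_buckets a m h \<S>)) \<le> \<theta> * real m}"
  shows "few \<in> sets (random_hash U m)"
    and "measure (random_hash U m) few
      \<le> measure_pmf.prob (binomial_pmf n (1 / real m)) {..a} ^ card \<S> / (1 - \<theta>)"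
proof -
  interpret prob_space "random_hash U m"
    using m_pos by (rule prob_space_random_hash)
  let ?never = "never_overloading_hashes U m a \<S>"
  have never_sets: "?never b \<in> events" if "b \<in> {..<m}" for b
    using that disjoint_family(1) block_sets by (intro sets_never_overloading_hashes) auto
  have few_eq: "few = {h \<in> space (random_hash U m).
      (1 - \<theta>) * real m \<le> real (card {b \<in> {..<m}. h \<in> ?never b})}"
    unfolding few_def
    by (intro Collect_cong conj_cong refl, subst card_never_overloaded) (auto simp: algebra_simps)
  have pos: "0 < (1 - \<theta>) * real m"
    using m_pos fraction_less by simp
  show "few \<in> events"
    unfolding few_eq using never_sets pos by (intro prob_card_events_ge_le) auto
  have "prob few \<le> (\<Sum>b<m. prob (?never b)) / ((1 - \<theta>) * real m)"
    unfolding few_eq using never_sets pos by (intro prob_card_events_ge_le) auto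
  also have "(\<Sum>b<m. prob (?never b))
      = real m * measure_pmf.prob (binomial_pmf n (1 / real m)) {..a} ^ card \<S>"
    using prob_never_overloading_hashes[OF _ disjoint_family block_sets] by simp
  finally show "prob few \<le> measure_pmf.prob (binomial_pmf n (1 / real m)) {..a} ^ card \<S> / (1 - \<theta>)"
    using m_pos by simp
qed

section \<open>The lower bound\<close>

lemma power_one_minus_le_of_mult_ge:
  fixes q :: real
  assumes "q \<le> 1" "20 / 27 \<le> real N * q"
  shows "(1 - q) ^ N \<le> 497 / 1000"
proof -
  have "1469 / 729 \<le> exp (20 / 27 :: real)"
    using exp_lower_Taylor_quadratic[of "20 / 27 :: real"] by (simp add: power2_eq_square)
  also have "\<dots> \<le> exp (real N * q)"
    using assms(2) by simp
  finally have exp_ge: "1469 / 729 \<le> exp (real N * q)" .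
  have "(1 - q) ^ N \<le> exp (- q) ^ N"
    using assms(1) exp_ge_add_one_self[of "- q"] by (intro power_mono) auto
  also have "\<dots> = exp (- (real N * q))"
    by (simp flip: exp_of_nat_mult)
  also have "\<dots> \<le> inverse (1469 / 729)"
    unfolding exp_minus using exp_ge by (intro le_imp_inverse_le) auto
  finally show ?thesis
    by simp
qed

lemma prob_binomial_atMost_power_le:
  fixes \<delta> :: real
  assumes capacity: "0 < a" "2 * a \<le> n" and buckets: "2 \<le> m"
    and mean_load: "\<delta> < 1" "real n = (1 - \<delta>) * real (a * m)"
    and many_blocks: "15 * exp (8 * tilt_exponent \<delta> a) \<le> real N"
  shows "measure_pmf.prob (binomial_pmf n (1 / real m)) {..a} ^ N \<le> 497 / 1000"
proof -
  let ?e = "tilt_exponent \<delta> a" and ?tail = "measure_pmf.prob (binomial_pmf n (1 / real m)) {a<..}"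
  have "20 / 27 \<le> 20 / 27 * exp (6 * ?e)"
    using mean_load(1) by (simp add: tilt_exponent_def)
  also have "\<dots> = (15 * exp (8 * ?e)) * (4 / 81 * exp (- 2 * ?e))"
    by (simp flip: exp_add)
  also have "\<dots> \<le> real N * ?tail"
    using many_blocks prob_binomial_pmf_greaterThan_ge[OF capacity buckets mean_load]
    by (intro mult_mono) auto
  finally have "(1 - ?tail) ^ N \<le> 497 / 1000"
    by (intro power_one_minus_le_of_mult_ge) auto
  moreover have "measure_pmf.prob (binomial_pmf n (1 / real m)) {..a} = 1 - ?tail"
    using measure_pmf.prob_compl[of "{a<..}" "binomial_pmf n (1 / real m)"]
    by (simp flip: Compl_eq_Diff_UNIV)
  ultimately show ?thesis
    by simp
qed

lemma prob_few_overloaded_blocks_less_half: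
  fixes \<delta> :: real and \<tau>s :: "'u list list"
  assumes capacity: "0 < a" "2 * a \<le> n" and buckets: "2 \<le> m"
    and mean_load: "\<delta> < 1" "real n = (1 - \<delta>) * real (a * m)"
    and blocks: "\<And>\<tau>. \<tau> \<in> set \<tau>s \<Longrightarrow> length \<tau> = n" "distinct (concat \<tau>s)" "set (concat \<tau>s) \<subseteq> U"
    and many_blocks: "15 * exp (8 * tilt_exponent \<delta> a) \<le> real (length \<tau>s)"
  defines "few \<equiv> {h \<in> space (random_hash U m).
    real (card (overloaded_buckets a m h (set ` set \<tau>s))) \<le> real m / 200}"
  shows "few \<in> sets (random_hash U m)" and "measure (random_hash U m) few < 1 / 2"
proof -
  have nonempty: "[] \<notin> set \<tau>s"
    using blocks(1) capacity by fastforce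
  then have distinct_blocks: "distinct \<tau>s"
    and disjoint_blocks: "\<And>\<tau> \<rho>. \<tau> \<in> set \<tau>s \<Longrightarrow> \<rho> \<in> set \<tau>s \<Longrightarrow> \<tau> \<noteq> \<rho> \<Longrightarrow> set \<tau> \<inter> set \<rho> = {}"
    using blocks(2) by (auto simp: distinct_concat_iff)
  have disjoint_sets: "disjoint (set ` set \<tau>s)"
    using disjoint_blocks by (auto simp: disjoint_def)
  have block_sets: "finite S \<and> card S = n \<and> S \<subseteq> U" if "S \<in> set ` set \<tau>s" for S
    using that blocks by (auto simp: distinct_concat_iff distinct_card)
  have "0 < m" "(1 / 200 :: real) < 1"
    using buckets by auto
  note few_overloaded =
    prob_few_overloaded_buckets_le[OF this(1) _ disjoint_sets block_sets this(2), of a]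
  show "few \<in> sets (random_hash U m)"
    unfolding few_def using few_overloaded(1) by simp
  have "inj_on set (set \<tau>s)"
    using disjoint_blocks nonempty by (intro inj_onI) (metis Int_absorb set_empty)
  then have "card (set ` set \<tau>s) = length \<tau>s"
    using distinct_blocks by (simp add: card_image distinct_card)
  with few_overloaded(2) show "measure (random_hash U m) few < 1 / 2"
    using prob_binomial_atMost_power_le[OF capacity buckets mean_load many_blocks] by (simp add: few_def)
qed

lemma misses_cycle_blocks_separation:
  fixes c D :: real
  assumes paging: "paging_algorithm A" and conservative: "conservative A"
    and "0 < a" "0 < k'" "0 \<le> c"
    and blocks: "\<And>\<tau>. \<tau> \<in> set \<tau>s \<Longrightarrow> length \<tau> = k'" "distinct (concat \<tau>s)"
    and hash_range: "h \<in> set (concat \<tau>s) \<rightarrow> {..<k div a}"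
    and gap: "c * real (length \<tau>s * k') + D
      < real (R * card (overloaded_buckets a (k div a) h (set ` set \<tau>s)))"
  shows "c * real (misses (A k') (cycle_blocks R \<tau>s)) + D
    < real (misses (set_associative A a k h) (cycle_blocks R \<tau>s))"
proof -
  have "misses (A k') (cycle_blocks R \<tau>s) \<le> length \<tau>s * k'"
    using conservative \<open>0 < k'\<close> blocks
    by (intro misses_cycle_blocks_conservative_le) (auto simp: distinct_concat_iff distinct_card)
  then have "c * real (misses (A k') (cycle_blocks R \<tau>s)) + D \<le> c * real (length \<tau>s * k') + D"
    using \<open>0 \<le> c\<close> by (intro add_right_mono mult_left_mono of_nat_mono) auto
  also note gap
  also have "real (R * card (overloaded_buckets a (k div a) h (set ` set \<tau>s)))
      \<le> real (misses (set_associative A a k h) (cycle_blocks R \<tau>s))"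
    using paging \<open>0 < a\<close> blocks(2) hash_range
    by (intro of_nat_mono misses_set_associative_cycle_blocks_ge) (auto simp: distinct_concat_iff)
  finally show ?thesis .
qed

definition competitive_hashes ::
  "(nat \<Rightarrow> 'u caching) \<Rightarrow> 'u set \<Rightarrow> nat \<Rightarrow> nat \<Rightarrow> nat \<Rightarrow> real \<Rightarrow> real \<Rightarrow> 'u list \<Rightarrow> ('u \<Rightarrow> nat) set" where
  "competitive_hashes A U a k k' c D \<sigma> = {h \<in> space (random_hash U (k div a)).
    real (misses (set_associative A a k h) \<sigma>) \<le> c * real (misses (A k') \<sigma>) + D}"

lemma competitive_hashes_subset_few_overloaded:
  fixes c D :: real
  assumes paging: "paging_algorithm A" and conservative: "conservative A"
    and "0 < a" "0 < k'" "0 \<le> c"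
    and blocks: "\<And>\<tau>. \<tau> \<in> set \<tau>s \<Longrightarrow> length \<tau> = k'" "distinct (concat \<tau>s)" "set (concat \<tau>s) \<subseteq> U"
    and many_passes: "c * real (length \<tau>s * k') + D < real R * t"
  shows "competitive_hashes A U a k k' c D (cycle_blocks R \<tau>s) \<subseteq> {h \<in> space (random_hash U (k div a)).
    real (card (overloaded_buckets a (k div a) h (set ` set \<tau>s))) \<le> t}"
proof (intro subsetI CollectI conjI)
  fix h assume competitive: "h \<in> competitive_hashes A U a k k' c D (cycle_blocks R \<tau>s)"
  then show "h \<in> space (random_hash U (k div a))"
    by (simp add: competitive_hashes_def)
  let ?overloaded = "overloaded_buckets a (k div a) h (set ` set \<tau>s)"
  show "real (card ?overloaded) \<le> t"
  proof (rule ccontr)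
    assume "\<not> ?thesis"
    then have "real R * t \<le> real (R * card ?overloaded)"
      unfolding of_nat_mult by (intro mult_left_mono) auto
    with many_passes have gap: "c * real (length \<tau>s * k') + D < real (R * card ?overloaded)"
      by linarith
    have "h \<in> set (concat \<tau>s) \<rightarrow> {..<k div a}"
      using competitive blocks(3) by (auto simp: competitive_hashes_def space_random_hash)
    from misses_cycle_blocks_separation[OF assms(1-5) blocks(1,2) this gap] show False
      using competitive by (simp add: competitive_hashes_def)
  qed
qed

lemma prob_competitive_hashes_less_half:
  fixes c D \<delta> :: real
  assumes paging: "paging_algorithm A" and conservative: "conservative A"
    and k_eq: "k = a * m" and buckets: "2 \<le> m" and capacity: "0 < a" "2 * a \<le> k'"
    and smaller_cache: "\<delta> < 1" "real k' = (1 - \<delta>) * real k" and c_nonneg: "0 \<le> c"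
    and blocks: "\<And>\<tau>. \<tau> \<in> set \<tau>s \<Longrightarrow> length \<tau> = k'" "distinct (concat \<tau>s)" "set (concat \<tau>s) \<subseteq> U"
    and many_blocks: "15 * exp (8 * tilt_exponent \<delta> a) \<le> real (length \<tau>s)"
    and many_passes: "c * real (length \<tau>s * k') + D < real R * (real m / 200)"
  shows "measure (random_hash U m) (competitive_hashes A U a k k' c D (cycle_blocks R \<tau>s)) < 1 / 2"
proof -
  interpret prob_space "random_hash U m"
    using buckets by (intro prob_space_random_hash) simp
  let ?few = "{h \<in> space (random_hash U m).
    real (card (overloaded_buckets a m h (set ` set \<tau>s))) \<le> real m / 200}"
  have few: "?few \<in> events" "prob ?few < 1 / 2"
    using prob_few_overloaded_blocks_less_half[OF capacity buckets smaller_cache(1) _ blocks many_blocks]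
      smaller_cache(2) k_eq by auto
  have "k div a = m"
    using k_eq capacity(1) by simp
  then have "competitive_hashes A U a k k' c D (cycle_blocks R \<tau>s) \<subseteq> ?few"
    using capacity competitive_hashes_subset_few_overloaded[OF paging conservative capacity(1) _ c_nonneg
        blocks many_passes, of k]
    by simp
  then have "prob (competitive_hashes A U a k k' c D (cycle_blocks R \<tau>s)) \<le> prob ?few"
    using few(1) by (rule finite_measure_mono)
  with few(2) show ?thesis
    by simp
qed

lemma augmented_cache_size:
  fixes \<delta> :: real
  assumes delta_range: "0 \<le> \<delta>" "\<delta> < 1" and a_pos: "0 < a"
    and augmented: "real k = inverse (1 - \<delta>) * real k'"
    and augmentation: "inverse (1 - \<delta>) \<le> real k / (2 * real a)"
  shows "real k' = (1 - \<delta>) * real k" "2 * a \<le> k'" "k' \<le> k"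
proof -
  show eq: "real k' = (1 - \<delta>) * real k"
    using augmented delta_range by (simp add: field_simps)
  have "2 * real a \<le> real k'"
    using augmentation a_pos delta_range unfolding eq by (simp add: field_simps)
  then show "2 * a \<le> k'"
    by linarith
  have "real k' \<le> real k"
    using delta_range unfolding eq by (simp add: mult_left_le_one_le)
  then show "k' \<le> k"
    by simp
qed

lemma obtain_block_count:
  fixes E :: real
  assumes "0 < n" "n \<le> k" "1 \<le> E"
  obtains N where "real (N * n) \<le> 16 * real k * E" "15 * E \<le> real N"
proof
  let ?N = "nat \<lfloor>16 * real k * E / real n\<rfloor>"
  have "real ?N \<le> 16 * real k * E / real n"
    using assms by simp
  then show "real (?N * n) \<le> 16 * real k * E"
    using assms(1) by (simp add: field_simps)
  have "16 * E * real n \<le> 16 * real k * E"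
    using assms by simp
  then have "16 * E \<le> 16 * real k * E / real n"
    using assms(1) by (simp add: pos_le_divide_eq)
  also have "\<dots> < real ?N + 1"
    using assms by simp
  finally show "15 * E \<le> real ?N"
    using assms(3) by linarith
qed

lemma obtain_blocks_in_universe:
  fixes E :: real
  assumes "0 < n" "n \<le> k" "1 \<le> E" and large_universe: "infinite U \<or> 16 * real k * E \<le> real (card U)"
  obtains \<tau>s where "\<And>\<tau>. \<tau> \<in> set \<tau>s \<Longrightarrow> length \<tau> = n" "distinct (concat \<tau>s)" "set (concat \<tau>s) \<subseteq> U"
    "real (length \<tau>s * n) \<le> 16 * real k * E" "15 * E \<le> real (length \<tau>s)"
proof -
  obtain N where block_count: "real (N * n) \<le> 16 * real k * E" "15 * E \<le> real N"
    using assms(1-3) by (rule obtain_block_count)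
  have "N * n \<le> card U" if "16 * real k * E \<le> real (card U)"
    using order.trans[OF block_count(1) that] by (simp only: of_nat_le_iff)
  with large_universe have "infinite U \<or> N * n \<le> card U"
    by blast
  then show ?thesis
    by (rule obtain_disjoint_lists) (use that block_count in blast)
qed

lemma obtain_pass_count:
  fixes c D E :: real
  assumes k_eq: "0 < k" "k = a * m" and items_le: "real n \<le> 16 * real k * E" and D_le: "D \<le> real k"
    and c_ge: "1 \<le> c" and E_ge: "1 \<le> E"
  obtains R where "c * real n + D < real R * (real m / 200)" "real R \<le> 3750 * (c * real a * E)"
proof
  let ?R = "nat \<lceil>3600 * (c * real a * E)\<rceil>"
  have ge_one: "1 \<le> c * real a * E"
    using k_eq c_ge E_ge by (intro mult_ge1_I) (auto simp: Suc_le_eq)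
  have "c * real n + D \<le> c * (16 * real k * E) + c * (real k * E)"
  proof (intro add_mono)
    show "c * real n \<le> c * (16 * real k * E)"
      using items_le c_ge by (intro mult_left_mono) auto
    have "1 * (real k * 1) \<le> c * (real k * E)"
      using c_ge E_ge by (intro mult_mono) auto
    with D_le show "D \<le> c * (real k * E)"
      by simp
  qed
  also have "\<dots> = 17 * (c * real k * E)"
    by simp
  also have "\<dots> < 18 * (c * real k * E)"
    using k_eq(1) c_ge E_ge by simp
  also have "\<dots> = 3600 * (c * real a * E) * (real m / 200)"
    by (simp add: k_eq(2))
  also have "\<dots> \<le> real ?R * (real m / 200)"
    by (intro mult_right_mono of_nat_ceiling) auto
  finally show "c * real n + D < real ?R * (real m / 200)" .
  have "real ?R \<le> 3600 * (c * real a * E) + 1"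
    using ge_one by linarith
  with ge_one show "real ?R \<le> 3750 * (c * real a * E)"
    by linarith
qed

lemma length_cycle_blocks_le:
  fixes c E :: real
  assumes "\<And>\<tau>. \<tau> \<in> set \<tau>s \<Longrightarrow> length \<tau> = n" and "0 \<le> c" "0 \<le> E"
    and "real (length \<tau>s * n) \<le> 16 * real k * E" and "real R \<le> 3750 * (c * real a * E)"
  shows "real (length (cycle_blocks R \<tau>s)) \<le> 60000 * (c * real a * real k * (E * E))"
proof -
  have "length (concat \<tau>s) = length \<tau>s * n"
    using assms(1) by (simp add: length_concat sum_list_triv cong: map_cong)
  then have "real (length (cycle_blocks R \<tau>s)) = real R * real (length \<tau>s * n)"
    by (simp add: length_cycle_blocks)
  also have "\<dots> \<le> (3750 * (c * real a * E)) * (16 * real k * E)"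
    using assms by (intro mult_mono) auto
  finally show ?thesis
    by (simp add: mult_ac)
qed

lemma ex_set_associative_hard_sequence:
  fixes A :: "nat \<Rightarrow> 'u caching" and \<delta> c D :: real
  assumes paging: "paging_algorithm A" and conservative: "conservative A"
    and k_dvd: "a dvd k" "0 < k" and delta_range: "0 \<le> \<delta>" "\<delta> < 1"
    and augmented: "real k = inverse (1 - \<delta>) * real k'" "inverse (1 - \<delta>) \<le> real k / (2 * real a)"
    and c_ge: "1 \<le> c" and D_le: "D \<le> real k"
    and large_universe: "infinite U \<or> 16 * real k * exp (8 * inverse (1 - \<delta>) * \<delta>\<^sup>2 * real a) \<le> real (card U)"
  shows "\<exists>\<sigma>. set \<sigma> \<subseteq> U \<and>
    real (length \<sigma>) \<le> 60000 * (c * real a * real k * exp (16 * inverse (1 - \<delta>) * \<delta>\<^sup>2 * real a)) \<and>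
    measure (random_hash U (k div a)) (competitive_hashes A U a k k' c D \<sigma>) < 1 / 2"
proof -
  define m E where "m = k div a" and "E = exp (8 * tilt_exponent \<delta> a)"
  have a_pos: "0 < a" and k_eq: "k = a * m"
    using k_dvd by (auto simp: m_def intro: Nat.gr0I)
  note k'_size = augmented_cache_size[OF delta_range a_pos augmented]
  have m_ge: "2 \<le> m"
    using k'_size(2,3) a_pos unfolding k_eq by (metis le_trans mult.commute nat_mult_le_cancel1)
  have E_ge: "1 \<le> E"
    using delta_range by (simp add: E_def tilt_exponent_def)
  have E_square: "E * E = exp (16 * inverse (1 - \<delta>) * \<delta>\<^sup>2 * real a)"
    by (simp add: E_def tilt_exponent_def mult.assoc flip: exp_add)
  have "0 < k'"
    using k'_size(2) a_pos by simp
  moreover have "infinite U \<or> 16 * real k * E \<le> real (card U)"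
    using large_universe by (simp add: E_def tilt_exponent_def mult.assoc)
  ultimately obtain \<tau>s where
    blocks: "\<And>\<tau>. \<tau> \<in> set \<tau>s \<Longrightarrow> length \<tau> = k'" "distinct (concat \<tau>s)" "set (concat \<tau>s) \<subseteq> U"
    and block_count: "real (length \<tau>s * k') \<le> 16 * real k * E" "15 * E \<le> real (length \<tau>s)"
    using obtain_blocks_in_universe[OF _ k'_size(3) E_ge] by metis
  obtain R where pass_count: "c * real (length \<tau>s * k') + D < real R * (real m / 200)"
    "real R \<le> 3750 * (c * real a * E)"
    using k_dvd(2) k_eq block_count(1) D_le c_ge E_ge by (rule obtain_pass_count)
  have "set (cycle_blocks R \<tau>s) \<subseteq> U"
    using set_cycle_blocks blocks(3) by (rule subset_trans)
  moreover have "real (length (cycle_blocks R \<tau>s)) \<le> 60000 * (c * real a * real k * (E * E))"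
    using blocks(1) c_ge E_ge block_count(1) pass_count(2) by (intro length_cycle_blocks_le) auto
  moreover have "measure (random_hash U m) (competitive_hashes A U a k k' c D (cycle_blocks R \<tau>s)) < 1 / 2"
    using c_ge by (intro prob_competitive_hashes_less_half[OF paging conservative k_eq m_ge a_pos k'_size(2)
      delta_range(2) k'_size(1) _ blocks block_count(2)[unfolded E_def] pass_count(1)]) simp
  ultimately show ?thesis
    unfolding E_square m_def by blast
qed

lemma not_competitiveI:
  assumes "\<exists>\<^sub>F k in sequentially. \<exists>k'::nat. real k = r k * real k'"
    and "\<And>D. \<forall>\<^sub>F k in sequentially. \<forall>k'. real k = r k * real k' \<longrightarrow>
      (\<exists>\<sigma>. set \<sigma> \<subseteq> U k \<and> real (length \<sigma>) \<le> l k \<and>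
        measure (M k) {\<omega> \<in> space (M k).
          real (misses (\<A> k \<omega>) \<sigma>) \<le> c * real (misses (\<B> k') \<sigma>) + D} < 1 / 2)"
  shows "not_competitive U M \<A> \<B> c r l"
  unfolding not_competitive_def
proof
  assume "competitive_with_prob U M \<A> \<B> c (1 / 2) r l"
  then obtain D where "\<forall>\<^sub>F k in sequentially. \<forall>k'. real k = r k * real k' \<longrightarrow>
      (\<forall>\<sigma>. set \<sigma> \<subseteq> U k \<and> real (length \<sigma>) \<le> l k \<longrightarrow>
        1 / 2 \<le> measure (M k) {\<omega> \<in> space (M k).
          real (misses (\<A> k \<omega>) \<sigma>) \<le> c * real (misses (\<B> k') \<sigma>) + D})"
    unfolding competitive_with_prob_def by blast
  with assms(2)[of D] have "\<forall>\<^sub>F k in sequentially. \<not> (\<exists>k'. real k = r k * real k')"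
    by eventually_elim (meson not_less)
  with assms(1) show False
    by (simp add: frequently_def)
qed

theorem theorem8:
  fixes A :: "nat \<Rightarrow> 'u caching"
    and U :: "nat \<Rightarrow> 'u set"
    and \<alpha> :: "nat \<Rightarrow> nat"
    and \<delta> :: "nat \<Rightarrow> real"
  assumes "paging_algorithm A" and "conservative A"
    and "\<And>k. \<alpha> k dvd k"
    and "\<And>k. 0 \<le> \<delta> k" and "\<And>k. \<delta> k < 1"
    and "\<exists>\<^sub>F k in sequentially. \<exists>k'::nat. real k = inverse (1 - \<delta> k) * real k'"
    and "\<forall>\<^sub>F k in sequentially. infinite (U k) \<or>
           real (card (U k)) \<ge> 16 * real k * exp (8 * inverse (1 - \<delta> k) * (\<delta> k)\<^sup>2 * real (\<alpha> k))"
    and "\<forall>\<^sub>F k in sequentially. inverse (1 - \<delta> k) \<le> real k / (2 * real (\<alpha> k))"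
  shows "\<exists>L>0. \<forall>c\<ge>1. not_competitive U
           (\<lambda>k. random_hash (U k) (k div \<alpha> k)) (\<lambda>k. set_associative A (\<alpha> k) k) A
           c (\<lambda>k. inverse (1 - \<delta> k))
           (\<lambda>k. L * (c * real (\<alpha> k) * real k *
                  exp (16 * inverse (1 - \<delta> k) * (\<delta> k)\<^sup>2 * real (\<alpha> k))))"
proof (intro exI[of _ "60000::real"] conjI allI impI not_competitiveI assms(6), goal_cases positive hard)
  case (hard c D)
  have "\<forall>\<^sub>F k in sequentially. D \<le> real k"
    using filterlim_real_sequentially by (simp add: filterlim_at_top)
  with assms(7,8) eventually_gt_at_top[of 0] show ?case
  proof eventually_elim
    case (elim k)
    then show ?case
      by (intro allI impI
          ex_set_associative_hard_sequence[unfolded competitive_hashes_def] assms hard)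
  qed
qed simp

end
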